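(* Let $n\geq 3$ be an integer, let $D_{2n}=\langle r,s\mid r^n,s^2,rsrs\rangle$ be the dihedral group of order $2n$, and let $A\subseteq D_{2n}$. Let $R$ be the set of rotations in $A$ and $F$ the set of flips in $A$. Suppose that $|F|>\frac n2$ or $|R|>\frac n2$. Then $A$ is not MDTS; that is, it is not the case that $|A+A|<|A-A|$.
   Context: For a subset $A$ of a (multiplicatively written) group, $A+A=\{a_1a_2:a_1,a_2\in A\}$ and $A-A=\{a_1a_2^{-1}:a_1,a_2\in A\}$. $A$ is MDTS (more differences than sums) if $|A+A|<|A-A|$. In $D_{2n}$, rotations are the elements of the form $r^i$ and flips are the elements of the form $r^is$. *)

theory Defs
  imports Complex_Main "HOL-Algebra.Coset"
begin

section \<open>Groups given by generators and relators\<close>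

text \<open>
  A letter \<open>(x, True)\<close> is the generator \<open>x\<close>, and \<open>(x, False)\<close> is its formal inverse.
\<close>

type_synonym 'g word = "('g \<times> bool) list"

inductive pres_eq :: "'g word set \<Rightarrow> 'g word \<Rightarrow> 'g word \<Rightarrow> bool" for R where
  pres_refl: "pres_eq R w w"
| pres_sym: "pres_eq R v w \<Longrightarrow> pres_eq R w v"
| pres_trans: "pres_eq R u v \<Longrightarrow> pres_eq R v w \<Longrightarrow> pres_eq R u w"
| pres_cancel: "pres_eq R (u @ [(x, b), (x, \<not> b)] @ v) (u @ v)"
| pres_relator: "w \<in> R \<Longrightarrow> pres_eq R (u @ w @ v) (u @ v)"

definition pres_rel :: "'g word set \<Rightarrow> 'g word rel" where
  "pres_rel R = {(v, w). pres_eq R v w}"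

text \<open>The group \<open>\<langle>UNIV :: 'g set | R\<rangle>\<close>: all elements of the type \<open>'g\<close> are generators.\<close>

definition presented_group :: "'g word set \<Rightarrow> 'g word set monoid" where
  "presented_group R =
     \<lparr>carrier = UNIV // pres_rel R,
      mult = (\<lambda>X Y. \<Union>x\<in>X. \<Union>y\<in>Y. pres_rel R `` {x @ y}),
      one = pres_rel R `` {[]}\<rparr>"

lemma equiv_pres_rel: "equiv UNIV (pres_rel R)"
  by (rule equivI)
     (auto simp: pres_rel_def refl_on_def sym_def trans_def intro: pres_eq.intros)

lemma pres_eq_context: "pres_eq R v w \<Longrightarrow> pres_eq R (a @ v @ b) (a @ w @ b)"
proof (induction rule: pres_eq.induct)
  case (pres_cancel u x c v)
  show ?case using pres_eq.pres_cancel[of R "a @ u" x c "v @ b"] by simp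
next
  case (pres_relator w u v)
  then show ?case using pres_eq.pres_relator[of w R "a @ u" "v @ b"] by simp
qed (blast intro: pres_eq.intros)+

lemma pres_eq_append:
  assumes "pres_eq R v v'" "pres_eq R w w'"
  shows "pres_eq R (v @ w) (v' @ w')"
proof (rule pres_trans)
  show "pres_eq R (v @ w) (v' @ w)" using pres_eq_context[OF assms(1), of "[]" w] by simp
  show "pres_eq R (v' @ w) (v' @ w')" using pres_eq_context[OF assms(2), of v' "[]"] by simp
qed

lemma pres_eq_Cons: "pres_eq R v w \<Longrightarrow> pres_eq R (x # v) (x # w)"
  using pres_eq_context[of R v w "[x]" "[]"] by simp

lemma pres_class_eq_iff: "pres_rel R `` {v} = pres_rel R `` {w} \<longleftrightarrow> pres_eq R v w"
  using eq_equiv_class_iff[OF equiv_pres_rel, of v w R] by (simp add: pres_rel_def)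

lemma presented_group_mult:
  "pres_rel R `` {v} \<otimes>\<^bsub>presented_group R\<^esub> pres_rel R `` {w} = pres_rel R `` {v @ w}"
proof -
  have "congruent2 (pres_rel R) (pres_rel R) (\<lambda>x y. pres_rel R `` {x @ y})"
  proof (rule congruent2I')
    fix y1 z1 y2 z2 assume "(y1, z1) \<in> pres_rel R" "(y2, z2) \<in> pres_rel R"
    then have "pres_eq R (y1 @ y2) (z1 @ z2)"
      by (auto simp: pres_rel_def intro: pres_eq_append)
    then show "pres_rel R `` {y1 @ y2} = pres_rel R `` {z1 @ z2}"
      by (simp only: pres_class_eq_iff)
  qed
  from UN_equiv_class2[OF equiv_pres_rel equiv_pres_rel this, of v w]
  show ?thesis by (simp add: presented_group_def)
qed

lemma pres_eq_inverse: "pres_eq R (rev (map (\<lambda>(x, b). (x, \<not> b)) w) @ w) []"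
proof (induction w)
  case (Cons p w)
  obtain x b where p: "p = (x, b)" by (cases p)
  let ?i = "rev (map (\<lambda>(x, b). (x, \<not> b)) w)"
  have "pres_eq R (?i @ [(x, \<not> b), (x, \<not> \<not> b)] @ w) (?i @ w)"
    by (rule pres_cancel)
  with Cons.IH p show ?case by (auto intro: pres_trans)
qed (auto intro: pres_refl)

lemma group_presented_group: "group (presented_group R)"
proof (rule groupI)
  fix X assume "X \<in> carrier (presented_group R)"
  then obtain w where X: "X = pres_rel R `` {w}"
    by (auto simp: presented_group_def quotient_def)
  let ?i = "rev (map (\<lambda>(x, b). (x, \<not> b)) w)"
  have "pres_rel R `` {?i} \<otimes>\<^bsub>presented_group R\<^esub> X = \<one>\<^bsub>presented_group R\<^esub>"
    unfolding X presented_group_mult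
    using pres_eq_inverse[of R w] by (simp add: presented_group_def pres_class_eq_iff)
  then show "\<exists>Y\<in>carrier (presented_group R). Y \<otimes>\<^bsub>presented_group R\<^esub> X = \<one>\<^bsub>presented_group R\<^esub>"
    by (auto simp: presented_group_def quotient_def)
next
  fix X assume "X \<in> carrier (presented_group R)"
  then obtain w where X: "X = pres_rel R `` {w}"
    by (auto simp: presented_group_def quotient_def)
  have "\<one>\<^bsub>presented_group R\<^esub> = pres_rel R `` {[]}" by (simp add: presented_group_def)
  then show "\<one>\<^bsub>presented_group R\<^esub> \<otimes>\<^bsub>presented_group R\<^esub> X = X"
    by (simp add: X presented_group_mult)
next
  fix X Y assume "X \<in> carrier (presented_group R)" "Y \<in> carrier (presented_group R)"
  then obtain v w where "X = pres_rel R `` {v}" "Y = pres_rel R `` {w}"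
    by (auto simp: presented_group_def quotient_def)
  then show "X \<otimes>\<^bsub>presented_group R\<^esub> Y \<in> carrier (presented_group R)"
    by (simp only: presented_group_mult) (auto simp: presented_group_def quotient_def)
next
  fix X Y Z
  assume "X \<in> carrier (presented_group R)" "Y \<in> carrier (presented_group R)"
    "Z \<in> carrier (presented_group R)"
  then obtain u v w
    where "X = pres_rel R `` {u}" "Y = pres_rel R `` {v}" "Z = pres_rel R `` {w}"
    by (auto simp: presented_group_def quotient_def)
  then show "X \<otimes>\<^bsub>presented_group R\<^esub> Y \<otimes>\<^bsub>presented_group R\<^esub> Z
    = X \<otimes>\<^bsub>presented_group R\<^esub> (Y \<otimes>\<^bsub>presented_group R\<^esub> Z)"
    by (simp add: presented_group_mult)
qed (auto simp: presented_group_def quotient_def)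


section \<open>Dihedral groups\<close>

datatype dihedral_gen = Gen_r | Gen_s

definition dihedral_relators :: "nat \<Rightarrow> dihedral_gen word set" where
  "dihedral_relators n =
     {replicate n (Gen_r, True),
      [(Gen_s, True), (Gen_s, True)],
      [(Gen_r, True), (Gen_s, True), (Gen_r, True), (Gen_s, True)]}"

definition dihedral :: "nat \<Rightarrow> dihedral_gen word set monoid" where
  "dihedral n = presented_group (dihedral_relators n)"

definition dihedral_r :: "nat \<Rightarrow> dihedral_gen word set" where
  "dihedral_r n = pres_rel (dihedral_relators n) `` {[(Gen_r, True)]}"

definition dihedral_s :: "nat \<Rightarrow> dihedral_gen word set" where
  "dihedral_s n = pres_rel (dihedral_relators n) `` {[(Gen_s, True)]}"

definition rotations :: "nat \<Rightarrow> dihedral_gen word set set" where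
  "rotations n = {dihedral_r n [^]\<^bsub>dihedral n\<^esub> i | i :: int. True}"

definition flips :: "nat \<Rightarrow> dihedral_gen word set set" where
  "flips n = {dihedral_r n [^]\<^bsub>dihedral n\<^esub> i \<otimes>\<^bsub>dihedral n\<^esub> dihedral_s n | i :: int. True}"

lemma group_dihedral: "group (dihedral n)"
  unfolding dihedral_def by (rule group_presented_group)

text \<open>
  The presented group acts on the pairs \<open>(i, b)\<close>, read as \<open>r\<^sup>i s\<^sup>b\<close>; the action separates
  the normal forms, which gives the order \<open>2n\<close>.
\<close>

context
  fixes n :: nat
  assumes n: "n > 0"
begin

private fun act :: "dihedral_gen \<times> bool \<Rightarrow> int \<times> bool \<Rightarrow> int \<times> bool" where
  "act (Gen_r, True) (i, b) = ((i + 1) mod int n, b)"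
| "act (Gen_r, False) (i, b) = ((i - 1) mod int n, b)"
| "act (Gen_s, _) (i, b) = ((- i) mod int n, \<not> b)"

private definition states :: "(int \<times> bool) set" where
  "states = {0..<int n} \<times> UNIV"

private fun nf :: "int \<times> bool \<Rightarrow> dihedral_gen word" where
  "nf (i, b) = replicate (nat i) (Gen_r, True) @ (if b then [(Gen_s, True)] else [])"

private abbreviation "E \<equiv> pres_eq (dihedral_relators n)"

private lemma act_states: "act l z \<in> states"
  using n by (cases "(l, z)" rule: act.cases) (auto simp: states_def)

private lemma foldr_act_states: "z \<in> states \<Longrightarrow> foldr act w z \<in> states"
  by (induction w) (auto simp: act_states)

private lemma act_replicate:
  "(i, b) \<in> states \<Longrightarrow> foldr act (replicate k (Gen_r, True)) (i, b) = ((i + int k) mod int n, b)"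
  by (induction k) (auto simp: states_def mod_simps algebra_simps)

private lemma act_cong:
  "E v w \<Longrightarrow> z \<in> states \<Longrightarrow> foldr act v z = foldr act w z"
proof (induction arbitrary: z rule: pres_eq.induct)
  case (pres_cancel u x b v)
  obtain i c where z: "foldr act v z = (i, c)" by fastforce
  with foldr_act_states[OF pres_cancel, of v] have "(i, c) \<in> states" by simp
  then have "act (x, b) (act (x, \<not> b) (i, c)) = (i, c)"
    by (cases x; cases b) (auto simp: states_def mod_simps)
  then show ?case by (simp add: z)
next
  case (pres_relator w u v)
  obtain i c where z: "foldr act v z = (i, c)" by fastforce
  with foldr_act_states[OF pres_relator(2), of v] have *: "(i, c) \<in> states" by simp
  have "foldr act w (i, c) = (i, c)"
    using pres_relator(1) * act_replicate[OF *, of n]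
    by (auto simp: dihedral_relators_def states_def mod_simps)
  then show ?case by (simp add: z)
qed auto

private lemma E_r_power: "E (replicate n (Gen_r, True)) []"
  using pres_relator[of _ "dihedral_relators n" "[]" "[]"] by (simp add: dihedral_relators_def)

private lemma E_s_square: "E ([(Gen_s, True), (Gen_s, True)] @ w) w"
  using pres_relator[of "[(Gen_s, True), (Gen_s, True)]" "dihedral_relators n" "[]" w]
  by (simp add: dihedral_relators_def)

private lemma E_s_inverse: "E ((Gen_s, False) # w) ((Gen_s, True) # w)"
proof (rule pres_trans)
  show "E ((Gen_s, False) # w) ((Gen_s, False) # [(Gen_s, True), (Gen_s, True)] @ w)"
    by (rule pres_eq_Cons[OF pres_sym[OF E_s_square]])
  show "E ((Gen_s, False) # [(Gen_s, True), (Gen_s, True)] @ w) ((Gen_s, True) # w)"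
    using pres_cancel[of _ "[]" "Gen_s" False "(Gen_s, True) # w"] by simp
qed

private lemma E_r_inverse: "E ((Gen_r, False) # w) (replicate (n - 1) (Gen_r, True) @ w)"
proof -
  have "E ((Gen_r, False) # replicate n (Gen_r, True) @ w) ((Gen_r, False) # w)"
    using pres_eq_context[OF E_r_power, of "[(Gen_r, False)]" w] by simp
  moreover have "replicate n (Gen_r, True) = (Gen_r, True) # replicate (n - 1) (Gen_r, True)"
    using n by (cases n) auto
  ultimately show ?thesis
    using pres_cancel[of _ "[]" "Gen_r" False "replicate (n - 1) (Gen_r, True) @ w"]
    by (auto intro: pres_trans pres_sym)
qed

private lemma E_replicate_mod:
  "E (replicate k (Gen_r, True) @ w) (replicate (k mod n) (Gen_r, True) @ w)"
proof (induction k rule: less_induct)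
  case (less k)
  show ?case
  proof (cases "k < n")
    case False
    then have "replicate k (Gen_r, True) = replicate n (Gen_r, True) @ replicate (k - n) (Gen_r, True)"
      by (simp add: replicate_add[symmetric])
    then have "E (replicate k (Gen_r, True) @ w) (replicate (k - n) (Gen_r, True) @ w)"
      using pres_eq_context[OF E_r_power, of "[]" "replicate (k - n) (Gen_r, True) @ w"] by simp
    moreover have "E (replicate (k - n) (Gen_r, True) @ w) (replicate (k mod n) (Gen_r, True) @ w)"
      using less[of "k - n"] False n by (simp add: le_mod_geq)
    ultimately show ?thesis by (rule pres_trans)
  qed (auto intro: pres_refl)
qed

private lemma E_s_r: "E ((Gen_s, True) # (Gen_r, True) # w) ((Gen_r, False) # (Gen_s, True) # w)"
proof -
  let ?r = "(Gen_r, True)" and ?s = "(Gen_s, True)"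
  have 1: "E ((Gen_r, False) # ?r # ?s # ?r # ?s # ?s # w) ((Gen_r, False) # ?s # w)"
    using pres_relator[of "[?r, ?s, ?r, ?s]" "dihedral_relators n" "[(Gen_r, False)]" "?s # w"]
    by (simp add: dihedral_relators_def)
  have 2: "E ((Gen_r, False) # ?r # ?s # ?r # ?s # ?s # w) (?s # ?r # ?s # ?s # w)"
    using pres_cancel[of _ "[]" "Gen_r" False "?s # ?r # ?s # ?s # w"] by simp
  have 3: "E (?s # ?r # ?s # ?s # w) (?s # ?r # w)"
    using E_s_square[of w] by (auto intro: pres_eq_Cons)
  from pres_trans[OF pres_sym[OF pres_trans[OF 2 3]] 1] show ?thesis .
qed

private lemma E_s_replicate:
  "E ((Gen_s, True) # replicate k (Gen_r, True) @ w)
     (replicate (k * (n - 1)) (Gen_r, True) @ (Gen_s, True) # w)"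
proof (induction k)
  case (Suc k)
  let ?r = "(Gen_r, True)" and ?s = "(Gen_s, True)"
  let ?m = "replicate (k * (n - 1)) ?r @ ?s # w"
  have 1: "E (?s # ?r # replicate k ?r @ w) ((Gen_r, False) # ?s # replicate k ?r @ w)"
    by (rule E_s_r)
  have 2: "E ((Gen_r, False) # ?s # replicate k ?r @ w) ((Gen_r, False) # ?m)"
    by (rule pres_eq_Cons[OF Suc.IH])
  have 3: "E ((Gen_r, False) # ?m) (replicate (n - 1) ?r @ ?m)"
    by (rule E_r_inverse)
  from pres_trans[OF pres_trans[OF 1 2] 3] show ?case by (simp add: replicate_add)
qed (auto intro: pres_refl)

private lemma E_act: "z \<in> states \<Longrightarrow> E (l # nf z) (nf (act l z))"
proof -
  assume z: "z \<in> states"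
  obtain i b where zi: "z = (int i, b)" and i: "i < n"
  proof
    show "z = (int (nat (fst z)), snd z)" "nat (fst z) < n"
      using z by (auto simp: states_def)
  qed
  let ?w = "if b then [(Gen_s, True)] else []"
  have r: "E (replicate j (Gen_r, True) @ w) (replicate (nat k) (Gen_r, True) @ w)"
    if "k = int j mod int n" for j k w
    using E_replicate_mod[of j w] that by (simp add: nat_mod_distrib)
  have s: "E ((Gen_s, True) # nf z) (nf (act (Gen_s, True) z))"
  proof -
    let ?k = "(- int i) mod int n"
    have k: "?k = int (i * (n - 1)) mod int n"
    proof -
      have "int (i * (n - 1)) = - int i + int i * int n"
        using n by (simp add: of_nat_diff algebra_simps)
      then show ?thesis by (simp only: mod_mult_self1)
    qed
    have "E ((Gen_s, True) # nf z) (replicate (nat ?k) (Gen_r, True) @ (Gen_s, True) # ?w)"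
      using pres_trans[OF E_s_replicate[of i ?w] r[OF k]] by (simp add: zi)
    moreover have "E (replicate (nat ?k) (Gen_r, True) @ (Gen_s, True) # ?w) (nf (?k, \<not> b))"
      using pres_eq_context[OF E_s_square[of "[]"], of "replicate (nat ?k) (Gen_r, True)" "[]"]
      by (auto intro: pres_refl)
    ultimately show ?thesis by (auto simp: zi intro: pres_trans simp del: nf.simps)
  qed
  obtain x c where l: "l = (x, c)" by (cases l)
  show ?thesis
  proof (cases x)
    case Gen_s
    with s E_s_inverse[of "nf z"] show ?thesis
      by (cases c) (auto simp: l zi simp del: nf.simps intro: pres_trans)
  next
    case Gen_r
    show ?thesis
    proof (cases c)
      case True
      with Gen_r r[of "(int i + 1) mod int n" "Suc i" ?w] show ?thesis
        by (simp add: l zi add.commute)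
    next
      case False
      have "int (n - 1 + i) = int i - 1 + int n" using n by simp
      then have "(int i - 1) mod int n = int (n - 1 + i) mod int n" by (simp only: mod_add_self2)
      from r[OF this, of ?w] pres_trans[OF E_r_inverse[of "nf z"]]
      show ?thesis using Gen_r False by (simp add: l zi replicate_add)
    qed
  qed
qed

private lemma zero_state: "(0, False) \<in> states"
  using n by (simp add: states_def)

private lemma E_nf: "E w (nf (foldr act w (0, False)))"
proof (induction w)
  case (Cons l w)
  from pres_trans[OF pres_eq_Cons[OF this] E_act[OF foldr_act_states[OF zero_state]]]
  show ?case by simp
qed (auto intro: pres_refl)

private lemma act_nf: "z \<in> states \<Longrightarrow> foldr act (nf z) (0, False) = z"
proof -
  assume z: "z \<in> states"
  obtain i b where zi: "z = (i, b)" by (cases z)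
  have "(0, b) \<in> states" using n by (simp add: states_def)
  from act_replicate[OF this, of "nat i"] z show ?thesis
    by (auto simp: zi states_def)
qed

lemma order_dihedral: "order (dihedral n) = 2 * n"
proof -
  let ?c = "\<lambda>w. pres_rel (dihedral_relators n) `` {w}"
  have "bij_betw (\<lambda>z. ?c (nf z)) states (carrier (dihedral n))"
    unfolding bij_betw_def
  proof
    show "inj_on (\<lambda>z. ?c (nf z)) states"
    proof (rule inj_onI)
      fix y z assume "y \<in> states" "z \<in> states" "?c (nf y) = ?c (nf z)"
      then show "y = z"
        using act_cong[of "nf y" "nf z" "(0, False)"] zero_state
        by (simp add: pres_class_eq_iff act_nf)
    qed
    have "?c w \<in> (\<lambda>z. ?c (nf z)) ` states" for w
      using E_nf[of w] foldr_act_states[OF zero_state, of w]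
      unfolding pres_class_eq_iff[symmetric] by blast
    then show "(\<lambda>z. ?c (nf z)) ` states = carrier (dihedral n)"
      by (auto simp: dihedral_def presented_group_def quotient_def)
  qed
  then have "card (carrier (dihedral n)) = card states"
    by (simp add: bij_betw_same_card)
  then show ?thesis
    by (simp add: order_def states_def card_cartesian_product mult.commute)
qed

end


section \<open>More differences than sums\<close>

definition MDTS :: "('a, 'b) monoid_scheme \<Rightarrow> 'a set \<Rightarrow> bool" where
  "MDTS G A \<longleftrightarrow> card (A <#>\<^bsub>G\<^esub> A) < card (A <#>\<^bsub>G\<^esub> (set_inv\<^bsub>G\<^esub> A))"

end

theory Submission
  imports Defs
begin

text \<open>
  In fact \<open>A - A \<subseteq> A + A\<close>. The only property of the dihedral group that matters is that the
  rotations form a subgroup \<open>H\<close> of index two outside of which every element is an involution.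

  A difference with one factor in \<open>H\<close> and one outside is a sum for every \<open>A\<close>: if \<open>t \<notin> H\<close>, then
  \<open>a t\<inverse> = a t\<close>, and for \<open>b \<in> H\<close> the element \<open>t b\<inverse>\<close> lies outside \<open>H\<close> too, so it equals its own
  inverse \<open>b t\<close>. Every other difference lies in \<open>H\<close>, and the size condition makes all of \<open>H\<close>
  consist of sums. This is the pigeonhole principle: two sets that each fill more than half of the same
  coset of \<open>H\<close> meet. For \<open>h \<in> H\<close> this applies to \<open>R\<close> and \<open>h R\<inverse>\<close>, or to \<open>F\<close> and \<open>h F\<close>, and a
  common element writes \<open>h\<close> as a sum (\<open>mem_set_mult_of_large_in_subgroup\<close>, \<open>mem_set_mult_of_large_outside\<close>).
\<close>

section \<open>Groups with involutions outside a subgroup of index two\<close>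

lemma large_subsets_meet:
  assumes "finite X" "S \<subseteq> X" "T \<subseteq> X" "card X < card S + card T"
  shows "S \<inter> T \<noteq> {}"
proof
  assume "S \<inter> T = {}"
  then have "card (S \<union> T) = card S + card T"
    using assms by (intro card_Un_disjoint) (auto intro: finite_subset)
  moreover have "card (S \<union> T) \<le> card X"
    using assms by (intro card_mono) auto
  ultimately show False using assms(4) by simp
qed

context group
begin

text \<open>The sets \<open>R\<close> and \<open>h R\<inverse>\<close> meet inside \<open>H\<close>, and \<open>x = h y\<inverse>\<close> means \<open>h = x y\<close>.\<close>

lemma mem_set_mult_of_large_in_subgroup:
  assumes H: "subgroup H G" "finite H" and R: "R \<subseteq> H" "card H < 2 * card R" and h: "h \<in> H"
  shows "h \<in> R <#> R"
proof -
  have HG: "H \<subseteq> carrier G" using H(1) by (rule subgroup.subset)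
  have "inj_on (\<lambda>x. h \<otimes> inv x) R"
    using HG R(1) h by (intro inj_onI) (auto simp: subset_iff dest: inj_onD[OF inv_inj])
  then have "card ((\<lambda>x. h \<otimes> inv x) ` R) = card R" by (rule card_image)
  moreover have "(\<lambda>x. h \<otimes> inv x) ` R \<subseteq> H"
    using H(1) R(1) h by (auto intro: subgroup.m_closed subgroup.m_inv_closed)
  ultimately obtain x where x: "x \<in> R" "x \<in> (\<lambda>x. h \<otimes> inv x) ` R"
    using large_subsets_meet[OF H(2) R(1), of "(\<lambda>x. h \<otimes> inv x) ` R"] R(2) by auto
  then obtain y where y: "y \<in> R" "x = h \<otimes> inv y" by auto
  have "x \<otimes> y = h" using HG R(1) h y by (auto simp: m_assoc subset_iff)
  with x(1) y(1) show ?thesis unfolding set_mult_def by blast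
qed

text \<open>
  The sets \<open>F\<close> and \<open>h F\<close> meet, and \<open>x = h y\<close> means \<open>h = x y\<close> because \<open>y\<close> is an involution. Both
  sets lie in one coset of \<open>H\<close>; left multiplication by an element \<open>t\<close> of that coset moves them
  into \<open>H\<close>, where they can be counted.
\<close>

lemma mem_set_mult_of_large_outside:
  assumes H: "subgroup H G" "finite H"
    and idx: "\<And>x y. x \<in> carrier G - H \<Longrightarrow> y \<in> carrier G - H \<Longrightarrow> x \<otimes> y \<in> H"
    and invol: "\<And>x. x \<in> carrier G - H \<Longrightarrow> x \<otimes> x = \<one>"
    and F: "F \<subseteq> carrier G - H" "card H < 2 * card F" and h: "h \<in> H"
  shows "h \<in> F <#> F"
proof -
  have HG: "H \<subseteq> carrier G" using H(1) by (rule subgroup.subset)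
  have FG: "F \<subseteq> carrier G" using F(1) by blast
  have hG: "h \<in> carrier G" using h HG by blast
  obtain t where t: "t \<in> F" using F(2) by (cases "F = {}") auto
  have tG: "t \<in> carrier G" using t FG by blast
  have th: "t \<otimes> h \<in> carrier G - H"
    using subgroup.m_closed[OF H(1), of "t \<otimes> h" "inv h"] subgroup.m_inv_closed[OF H(1) h]
      t F(1) tG hG by (auto simp: m_assoc)
  have inj: "inj_on (\<lambda>x. u \<otimes> x) F" if "u \<in> carrier G" for u
    using FG that by (intro inj_onI) (auto simp: subset_iff)
  have "(\<lambda>x. t \<otimes> x) ` F \<subseteq> H" "(\<lambda>x. (t \<otimes> h) \<otimes> x) ` F \<subseteq> H"
    using idx t th F(1) by blast+
  moreover have "card ((\<lambda>x. t \<otimes> x) ` F) = card F" "card ((\<lambda>x. (t \<otimes> h) \<otimes> x) ` F) = card F"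
    using tG th by (auto intro!: card_image inj)
  ultimately obtain z where z: "z \<in> (\<lambda>x. t \<otimes> x) ` F" "z \<in> (\<lambda>x. (t \<otimes> h) \<otimes> x) ` F"
    using large_subsets_meet[OF H(2), of "(\<lambda>x. t \<otimes> x) ` F" "(\<lambda>x. (t \<otimes> h) \<otimes> x) ` F"] F(2)
    by auto
  then obtain x y where xy: "x \<in> F" "y \<in> F" "t \<otimes> x = (t \<otimes> h) \<otimes> y" by auto
  have G: "x \<in> carrier G" "y \<in> carrier G" using xy FG by auto
  have "x = h \<otimes> y" using xy(3) G tG hG by (simp add: m_assoc)
  then have "x \<otimes> y = h" using G hG invol[of y] xy(2) F(1) by (auto simp: m_assoc)
  with xy show ?thesis unfolding set_mult_def by blast
qed

text \<open>
  By the two preceding lemmas \<open>H \<subseteq> A + A\<close>, which settles the differences of two elements on the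
  same side of \<open>H\<close>; mixed differences are rewritten as sums one by one.
\<close>

lemma differences_subset_sums:
  assumes H: "subgroup H G" "finite H"
    and idx: "\<And>x y. x \<in> carrier G - H \<Longrightarrow> y \<in> carrier G - H \<Longrightarrow> x \<otimes> y \<in> H"
    and invol: "\<And>x. x \<in> carrier G - H \<Longrightarrow> x \<otimes> x = \<one>"
    and A: "A \<subseteq> carrier G"
    and large: "card H < 2 * card (A - H) \<or> card H < 2 * card (A \<inter> H)"
  shows "A <#> (set_inv A) \<subseteq> A <#> A"
proof -
  have H_sums: "H \<subseteq> A <#> A"
  proof
    fix h assume h: "h \<in> H"
    from large have "h \<in> (A - H) <#> (A - H) \<or> h \<in> (A \<inter> H) <#> (A \<inter> H)"
    proof
      assume l: "card H < 2 * card (A - H)"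
      have "h \<in> (A - H) <#> (A - H)"
        using A by (intro mem_set_mult_of_large_outside[OF H idx invol _ l h]) auto
      then show ?thesis ..
    next
      assume l: "card H < 2 * card (A \<inter> H)"
      show ?thesis using mem_set_mult_of_large_in_subgroup[OF H _ l h] by simp
    qed
    then show "h \<in> A <#> A" unfolding set_mult_def by blast
  qed
  have self_inv: "inv x = x" if "x \<in> carrier G - H" for x
    using invol[OF that] that by (intro inv_equality) auto
  have "a \<otimes> inv b \<in> A <#> A" if ab: "a \<in> A" "b \<in> A" for a b
  proof -
    have G: "a \<in> carrier G" "b \<in> carrier G" using ab A by auto
    consider "a \<in> H" "b \<in> H" | "b \<notin> H" | "a \<notin> H" "b \<in> H" by blast
    then show ?thesis
    proof cases
      case 1
      then have "a \<otimes> inv b \<in> H" by (simp add: H(1) subgroup.m_closed subgroup.m_inv_closed)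
      then show ?thesis using H_sums by blast
    next
      case 2
      then have "a \<otimes> inv b = a \<otimes> b" using self_inv[of b] G by simp
      then show ?thesis using ab unfolding set_mult_def by blast
    next
      case 3
      have "a \<otimes> inv b \<notin> H"
        using subgroup.m_closed[OF H(1), of "a \<otimes> inv b" b] 3 G by (auto simp: m_assoc)
      then have "inv (a \<otimes> inv b) = a \<otimes> inv b" using self_inv G by simp
      moreover have "inv (a \<otimes> inv b) = b \<otimes> a"
        using G 3 self_inv[of a] by (simp add: inv_mult_group)
      ultimately have "a \<otimes> inv b = b \<otimes> a" by simp
      then show ?thesis using ab unfolding set_mult_def by blast
    qed
  qed
  then show ?thesis unfolding set_mult_def SET_INV_def by blast
qed

text \<open>
  If \<open>r s r s\<close> and \<open>s s\<close> are trivial, then \<open>s r s\<close> inverts \<open>r\<close>; conjugation by \<open>s\<close> is a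
  homomorphism, so it inverts every power of \<open>r\<close>.
\<close>

lemma involution_times_int_pow:
  assumes G: "r \<in> carrier G" "s \<in> carrier G"
    and s2: "s \<otimes> s = \<one>" and rel: "r \<otimes> s \<otimes> r \<otimes> s = \<one>"
  shows "s \<otimes> r [^] (i::int) = r [^] (- i) \<otimes> s"
proof -
  have inv_s: "inv s = s" using s2 G by (intro inv_equality) auto
  have ss: "s \<otimes> (s \<otimes> x) = x" if "x \<in> carrier G" for x
    using G s2 that by (simp add: m_assoc[symmetric])
  have conj: "s \<otimes> x \<otimes> s \<otimes> (s \<otimes> y \<otimes> s) = s \<otimes> (x \<otimes> y) \<otimes> s"
    if "x \<in> carrier G" "y \<in> carrier G" for x y
    using G that by (simp add: m_assoc ss)
  then have hom: "(\<lambda>x. s \<otimes> x \<otimes> s) \<in> hom G G" using G by (auto simp: hom_def)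
  have "(r \<otimes> s \<otimes> r) \<otimes> s = \<one>" using rel .
  then have "(s \<otimes> r \<otimes> s) \<otimes> r = \<one>"
    using G by (metis inv_comm m_assoc m_closed)
  then have srs: "s \<otimes> r \<otimes> s = inv r" using G by (intro inv_equality[symmetric]) auto
  have "s \<otimes> r [^] i \<otimes> s = (s \<otimes> r \<otimes> s) [^] i"
    using group_hom.hom_int_pow[of G G "\<lambda>x. s \<otimes> x \<otimes> s" r i] hom G
    by (simp add: group_hom_def group_hom_axioms_def is_group)
  also have "\<dots> = r [^] (- i)" using G by (simp add: srs int_pow_inv int_pow_neg)
  finally have "s \<otimes> r [^] i \<otimes> s \<otimes> s = r [^] (- i) \<otimes> s" by simp
  then show ?thesis using G s2 by (simp add: m_assoc)
qed

end

section \<open>Rotations and flips in the dihedral group\<close>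

lemma dihedral_generators:
  shows "dihedral_r n \<in> carrier (dihedral n)" "dihedral_s n \<in> carrier (dihedral n)"
  by (auto simp: dihedral_def dihedral_r_def dihedral_s_def presented_group_def quotient_def)

lemma dihedral_class_Cons:
  "pres_rel (dihedral_relators n) `` {l # w} =
     pres_rel (dihedral_relators n) `` {[l]} \<otimes>\<^bsub>dihedral n\<^esub> pres_rel (dihedral_relators n) `` {w}"
  by (simp add: dihedral_def presented_group_mult)

lemma dihedral_class_Nil: "pres_rel (dihedral_relators n) `` {[]} = \<one>\<^bsub>dihedral n\<^esub>"
  by (simp add: dihedral_def presented_group_def)

lemma dihedral_relator_class:
  "w \<in> dihedral_relators n \<Longrightarrow> pres_rel (dihedral_relators n) `` {w} = \<one>\<^bsub>dihedral n\<^esub>"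
  using pres_relator[of w "dihedral_relators n" "[]" "[]"]
  by (simp add: dihedral_class_Nil[symmetric] pres_class_eq_iff)

lemma dihedral_s_square: "dihedral_s n \<otimes>\<^bsub>dihedral n\<^esub> dihedral_s n = \<one>\<^bsub>dihedral n\<^esub>"
  using dihedral_relator_class[of "[(Gen_s, True), (Gen_s, True)]" n]
  by (simp add: dihedral_relators_def dihedral_s_def dihedral_def presented_group_mult)

lemma dihedral_rsrs:
  "dihedral_r n \<otimes>\<^bsub>dihedral n\<^esub> dihedral_s n \<otimes>\<^bsub>dihedral n\<^esub> dihedral_r n \<otimes>\<^bsub>dihedral n\<^esub> dihedral_s n
     = \<one>\<^bsub>dihedral n\<^esub>"
  using dihedral_relator_class[of "[(Gen_r, True), (Gen_s, True), (Gen_r, True), (Gen_s, True)]" n]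
  by (simp add: dihedral_relators_def dihedral_r_def dihedral_s_def dihedral_def presented_group_mult)

lemma dihedral_r_power: "dihedral_r n [^]\<^bsub>dihedral n\<^esub> n = \<one>\<^bsub>dihedral n\<^esub>"
proof -
  interpret group "dihedral n" by (rule group_dihedral)
  have "pres_rel (dihedral_relators n) `` {replicate k (Gen_r, True)} = dihedral_r n [^]\<^bsub>dihedral n\<^esub> k"
    for k
  proof (induction k)
    case (Suc k)
    then show ?case
      using dihedral_generators[of n] nat_pow_Suc2[of "dihedral_r n" k]
        dihedral_class_Cons[of n "(Gen_r, True)" "replicate k (Gen_r, True)"]
      by (simp add: dihedral_r_def)
  qed (simp add: dihedral_class_Nil)
  then show ?thesis
    using dihedral_relator_class[of "replicate n (Gen_r, True)" n] by (simp add: dihedral_relators_def)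
qed

lemma dihedral_inverse_letter:
  "pres_rel (dihedral_relators n) `` {[(x, False)]} =
     inv\<^bsub>dihedral n\<^esub> (pres_rel (dihedral_relators n) `` {[(x, True)]})"
proof -
  interpret group "dihedral n" by (rule group_dihedral)
  have G: "pres_rel (dihedral_relators n) `` {w} \<in> carrier (dihedral n)" for w
    by (auto simp: dihedral_def presented_group_def quotient_def)
  have "pres_eq (dihedral_relators n) [(x, False), (x, True)] []"
    using pres_cancel[of "dihedral_relators n" "[]" x False "[]"] by simp
  then show ?thesis
    using G by (intro inv_equality[symmetric])
      (simp_all add: dihedral_class_Cons[symmetric] dihedral_class_Nil[symmetric] pres_class_eq_iff)
qed

lemma rotations_subgroup: "subgroup (rotations n) (dihedral n)"
proof -
  interpret group "dihedral n" by (rule group_dihedral)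
  note r = dihedral_generators(1)[of n]
  show ?thesis
  proof (rule subgroupI)
    show "rotations n \<subseteq> carrier (dihedral n)" "rotations n \<noteq> {}"
      using r by (auto simp: rotations_def)
    show "inv\<^bsub>dihedral n\<^esub> a \<in> rotations n" if "a \<in> rotations n" for a
      using that int_pow_neg[OF r] unfolding rotations_def by (fastforce simp: r)
    show "a \<otimes>\<^bsub>dihedral n\<^esub> b \<in> rotations n" if "a \<in> rotations n" "b \<in> rotations n" for a b
      using that int_pow_mult[OF r] unfolding rotations_def by fastforce
  qed
qed

text \<open>
  By induction on a word: left multiplication by \<open>r\<close> or its inverse shifts the exponent in
  \<open>r\<^sup>i\<close> and \<open>r\<^sup>i s\<close>, and left multiplication by \<open>s\<close>, which is its own inverse, swaps the two forms
  because \<open>s r\<^sup>i = r\<^sup>-\<^sup>i s\<close>.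
\<close>

lemma dihedral_carrier: "carrier (dihedral n) = rotations n \<union> flips n"
proof -
  interpret group "dihedral n" by (rule group_dihedral)
  let ?r = "dihedral_r n" and ?s = "dihedral_s n"
  note G = dihedral_generators[of n]
  note swap = involution_times_int_pow[OF G dihedral_s_square dihedral_rsrs]
  have rI: "?r [^]\<^bsub>dihedral n\<^esub> i \<in> rotations n \<union> flips n" for i :: int
    by (auto simp: rotations_def)
  have fI: "?r [^]\<^bsub>dihedral n\<^esub> i \<otimes>\<^bsub>dihedral n\<^esub> ?s \<in> rotations n \<union> flips n" for i :: int
    by (auto simp: flips_def)
  have rpow: "?r [^]\<^bsub>dihedral n\<^esub> j \<otimes>\<^bsub>dihedral n\<^esub> x \<in> rotations n \<union> flips n"
    if "x \<in> rotations n \<union> flips n" for x and j :: int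
    using that rI fI G
    by (auto simp: rotations_def flips_def int_pow_mult[symmetric] m_assoc[symmetric]
        simp del: Un_iff)
  have sx: "?s \<otimes>\<^bsub>dihedral n\<^esub> x \<in> rotations n \<union> flips n"
    if "x \<in> rotations n \<union> flips n" for x
  proof -
    have "?s \<otimes>\<^bsub>dihedral n\<^esub> (?r [^]\<^bsub>dihedral n\<^esub> i \<otimes>\<^bsub>dihedral n\<^esub> ?s) = ?r [^]\<^bsub>dihedral n\<^esub> (- i)" for i :: int
      using swap[of i] G by (simp add: m_assoc[symmetric]) (simp add: m_assoc dihedral_s_square)
    then show ?thesis
      using that rI fI swap by (auto simp: rotations_def flips_def simp del: Un_iff)
  qed
  have inv_s: "inv\<^bsub>dihedral n\<^esub> ?s = ?s" using dihedral_s_square G by (intro inv_equality) auto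
  have r1: "?r [^]\<^bsub>dihedral n\<^esub> (1::int) = ?r" "?r [^]\<^bsub>dihedral n\<^esub> (-1::int) = inv\<^bsub>dihedral n\<^esub> ?r"
    using G by (simp_all add: int_pow_neg)
  have "pres_rel (dihedral_relators n) `` {w} \<in> rotations n \<union> flips n" for w
  proof (induction w)
    case Nil
    show ?case using rI[of 0] by (simp add: dihedral_class_Nil)
  next
    case (Cons l w)
    obtain x b where l: "l = (x, b)" by (cases l)
    show ?case
      using Cons.IH rpow[OF Cons.IH, of 1] rpow[OF Cons.IH, of "-1"] sx[OF Cons.IH] inv_s r1
      by (cases x; cases b)
        (simp_all add: dihedral_class_Cons[of n _ w] l dihedral_inverse_letter
          dihedral_r_def[symmetric] dihedral_s_def[symmetric] del: Un_iff)
  qed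
  then have "carrier (dihedral n) \<subseteq> rotations n \<union> flips n"
    by (auto simp: dihedral_def presented_group_def quotient_def)
  then show ?thesis using G by (auto simp: rotations_def flips_def)
qed

text \<open>
  As \<open>r\<^sup>n = 1\<close>, there are at most \<open>n\<close> rotations and at most \<open>n\<close> flips; together they are \<open>2n\<close>
  elements, so nothing coincides.
\<close>

lemma
  assumes "n > 0"
  shows card_rotations: "card (rotations n) = n"
    and flips_eq: "flips n = carrier (dihedral n) - rotations n"
proof -
  interpret group "dihedral n" by (rule group_dihedral)
  let ?r = "dihedral_r n" and ?s = "dihedral_s n"
  note G = dihedral_generators[of n]
  have pow: "?r [^]\<^bsub>dihedral n\<^esub> i = ?r [^]\<^bsub>dihedral n\<^esub> nat (i mod int n)" for i :: int
  proof -
    have "?r [^]\<^bsub>dihedral n\<^esub> i = ?r [^]\<^bsub>dihedral n\<^esub> (int n * (i div int n) + i mod int n)" by simp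
    also have "\<dots> = (?r [^]\<^bsub>dihedral n\<^esub> int n) [^]\<^bsub>dihedral n\<^esub> (i div int n)
        \<otimes>\<^bsub>dihedral n\<^esub> ?r [^]\<^bsub>dihedral n\<^esub> (i mod int n)"
      using G by (simp only: int_pow_mult int_pow_pow)
    also have "\<dots> = ?r [^]\<^bsub>dihedral n\<^esub> (i mod int n)"
      using G dihedral_r_power[of n] by (simp add: int_pow_int)
    also have "\<dots> = ?r [^]\<^bsub>dihedral n\<^esub> int (nat (i mod int n))" using assms by simp
    finally show ?thesis by (simp only: int_pow_int)
  qed
  have lt: "nat (i mod int n) < n" for i
    using assms by (simp add: nat_less_iff)
  have rot: "rotations n \<subseteq> (\<lambda>k. ?r [^]\<^bsub>dihedral n\<^esub> k) ` {..<n}"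
    using pow lt by (auto simp: rotations_def)
  have fl: "flips n \<subseteq> (\<lambda>k. ?r [^]\<^bsub>dihedral n\<^esub> k \<otimes>\<^bsub>dihedral n\<^esub> ?s) ` {..<n}"
    using pow lt by (auto simp: flips_def)
  have fin: "finite (rotations n)" "finite (flips n)"
    using rot fl by (auto intro: finite_subset)
  have le: "card (rotations n) \<le> n" "card (flips n) \<le> n"
    using surj_card_le[OF _ rot] surj_card_le[OF _ fl] by auto
  have sum: "card (rotations n) + card (flips n)
      = 2 * n + card (rotations n \<inter> flips n)"
    using card_Un_Int[OF fin] order_dihedral[OF assms] by (simp add: order_def dihedral_carrier)
  then show "card (rotations n) = n" using le by linarith
  have "card (rotations n \<inter> flips n) = 0" using sum le by linarith
  then have "rotations n \<inter> flips n = {}" using fin by simp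
  then show "flips n = carrier (dihedral n) - rotations n" using dihedral_carrier[of n] by blast
qed

lemma flip_mult_flip:
  fixes n :: nat and i j :: int
  defines "r \<equiv> dihedral_r n" and "s \<equiv> dihedral_s n"
  shows "(r [^]\<^bsub>dihedral n\<^esub> i \<otimes>\<^bsub>dihedral n\<^esub> s) \<otimes>\<^bsub>dihedral n\<^esub> (r [^]\<^bsub>dihedral n\<^esub> j \<otimes>\<^bsub>dihedral n\<^esub> s)
    = r [^]\<^bsub>dihedral n\<^esub> (i - j)"
proof -
  interpret group "dihedral n" by (rule group_dihedral)
  have G: "r \<in> carrier (dihedral n)" "s \<in> carrier (dihedral n)"
    using dihedral_generators by (simp_all add: r_def s_def)
  have s2: "s \<otimes>\<^bsub>dihedral n\<^esub> s = \<one>\<^bsub>dihedral n\<^esub>"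
    by (simp add: s_def dihedral_s_square)
  have swap: "s \<otimes>\<^bsub>dihedral n\<^esub> r [^]\<^bsub>dihedral n\<^esub> j = r [^]\<^bsub>dihedral n\<^esub> (- j) \<otimes>\<^bsub>dihedral n\<^esub> s"
    using involution_times_int_pow[OF dihedral_generators dihedral_s_square dihedral_rsrs]
    by (simp add: r_def s_def)
  have "(r [^]\<^bsub>dihedral n\<^esub> i \<otimes>\<^bsub>dihedral n\<^esub> s) \<otimes>\<^bsub>dihedral n\<^esub> (r [^]\<^bsub>dihedral n\<^esub> j \<otimes>\<^bsub>dihedral n\<^esub> s)
      = r [^]\<^bsub>dihedral n\<^esub> i \<otimes>\<^bsub>dihedral n\<^esub> ((s \<otimes>\<^bsub>dihedral n\<^esub> r [^]\<^bsub>dihedral n\<^esub> j) \<otimes>\<^bsub>dihedral n\<^esub> s)"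
    using G by (simp add: m_assoc)
  also have "\<dots> = r [^]\<^bsub>dihedral n\<^esub> i \<otimes>\<^bsub>dihedral n\<^esub> r [^]\<^bsub>dihedral n\<^esub> (- j)"
    unfolding swap using G s2 by (simp add: m_assoc)
  also have "\<dots> = r [^]\<^bsub>dihedral n\<^esub> (i - j)"
    using int_pow_mult[OF G(1), of i "- j"] by simp
  finally show ?thesis .
qed

theorem lemma1p5:
  fixes n :: nat and A R F :: "dihedral_gen word set set"
  assumes "n \<ge> 3"
    and "A \<subseteq> carrier (dihedral n)"
    and "R = A \<inter> rotations n"
    and "F = A \<inter> flips n"
    and "real (card F) > real n / 2 \<or> real (card R) > real n / 2"
  shows "\<not> MDTS (dihedral n) A"
proof -
  interpret group "dihedral n" by (rule group_dihedral)
  have n: "n > 0" using assms(1) by simp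
  have fin: "finite (carrier (dihedral n))"
    using order_dihedral[OF n] n by (intro card_ge_0_finite) (simp add: order_def)
  have "F = A - rotations n" using assms(2,4) flips_eq[OF n] by blast
  then have large: "card (rotations n) < 2 * card (A - rotations n)
      \<or> card (rotations n) < 2 * card (A \<inter> rotations n)"
    using assms(3,5) card_rotations[OF n] by (auto simp: field_simps)
  have "A <#>\<^bsub>dihedral n\<^esub> (set_inv\<^bsub>dihedral n\<^esub> A) \<subseteq> A <#>\<^bsub>dihedral n\<^esub> A"
  proof (rule differences_subset_sums[OF rotations_subgroup _ _ _ assms(2) large])
    show "finite (rotations n)"
      using fin subgroup.subset[OF rotations_subgroup] by (rule rev_finite_subset)
    show "x \<otimes>\<^bsub>dihedral n\<^esub> y \<in> rotations n"
      if "x \<in> carrier (dihedral n) - rotations n" "y \<in> carrier (dihedral n) - rotations n" for x y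
      using that unfolding flips_eq[OF n, symmetric]
      by (auto simp: flips_def rotations_def flip_mult_flip)
    show "x \<otimes>\<^bsub>dihedral n\<^esub> x = \<one>\<^bsub>dihedral n\<^esub>"
      if "x \<in> carrier (dihedral n) - rotations n" for x
      using that unfolding flips_eq[OF n, symmetric]
      by (auto simp: flips_def flip_mult_flip)
  qed
  moreover have "finite (A <#>\<^bsub>dihedral n\<^esub> A)"
    using set_mult_closed[OF assms(2) assms(2)] fin by (rule finite_subset)
  ultimately have "card (A <#>\<^bsub>dihedral n\<^esub> (set_inv\<^bsub>dihedral n\<^esub> A)) \<le> card (A <#>\<^bsub>dihedral n\<^esub> A)"
    by (intro card_mono)
  then show ?thesis by (simp add: MDTS_def)
qed

end
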